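(* Let $K$ be a field and let $M$ be the matrix of a graded twisting map $\tau:K[y]\otimes K[x]\to K[x]\otimes K[y]$ with $M_{1*}=(1,-1,1,0,0,\dots)$, and set $\widetilde{M}:=M-Y$. Let $n\in\mathbb{N}$ with $n\ge 2$ and assume that $\widetilde{M}_{k*}=\widetilde{M}_{0*}$ for $1<k<n$ and that $\widetilde{M}_{n*}\neq\widetilde{M}_{0*}$. Rename the only possibly nonzero entries of the $n$-th row of $\widetilde{M}$ (those in columns $0,1,n,n+1$) as $$a:=\widetilde{M}_{n,n+1},\quad b:=\widetilde{M}_{n,n},\quad c:=\widetilde{M}_{n,1},\quad d:=\widetilde{M}_{n,0}.$$ Then either (1) $(d,c,b,a)=(d,-d,-a,a)$ with $(d,a)\neq(1,0)$, or (2) $(d,c,b,a)=(d,-1,0,a)$ with $a\neq 0$ and $d(a+1)=1$.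
   Context: $\mathbb{N}=\{1,2,\dots\}$, $\mathbb{N}_0=\mathbb{N}\cup\{0\}$. Tensor products are over $K$; $\mu_{K[x]},\mu_{K[y]}$ denote multiplication. $L(K^{\mathbb{N}_0})$ is the algebra of infinite matrices over $K$ indexed by $\mathbb{N}_0\times\mathbb{N}_0$ with finitely many nonzero entries in each row; $Y$ is the matrix with $Y_{ij}=\delta_{i+1,j}$; $A_{k*}$ is the $k$-th row of $A$. A twisting map is a $K$-linear map $\tau:K[y]\otimes K[x]\to K[x]\otimes K[y]$ such that $\tau(1\otimes f)=f\otimes 1$ and $\tau(y^r\otimes 1)=1\otimes y^r$ for all $f\in K[x]$, $r\ge 0$; $\tau\circ(\mathrm{id}_{K[y]}\otimes\mu_{K[x]})=(\mu_{K[x]}\otimes \mathrm{id}_{K[y]})\circ(\mathrm{id}_{K[x]}\otimes\tau)\circ(\tau\otimes \mathrm{id}_{K[x]})$; and $\tau\circ(\mu_{K[y]}\otimes\mathrm{id}_{K[x]})=(\mathrm{id}_{K[x]}\otimes\mu_{K[y]})\circ(\tau\otimes\mathrm{id}_{K[y]})\circ(\mathrm{id}_{K[y]}\otimes\tau)$. It is graded if $\tau(y^r\otimes x^i)$ lies in the span of $\{x^{r+i-j}\otimes y^j:0\le j\le r+i\}$ for all $r,i$. The matrix of a graded twisting map $\tau$ is the matrix $M\in L(K^{\mathbb{N}_0})$ with $\tau(y^k\otimes x)=\sum_{j=0}^{k+1}M_{kj}\,x^{k+1-j}\otimes y^j$ and $M_{kj}=0$ for $j>k+1$. A matrix $M\in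 L(K^{\mathbb{N}_0})$ is the matrix of a (unique) graded twisting map if and only if $M_{0j}=\delta_{0j}$, $M_{kj}=0$ for $j>k+1$, and $Y^kM=\sum_{j=0}^{k+1}M_{kj}M^{k+1-j}Y^j$ for all $k\in\mathbb{N}_0$. *)

theory Defs
  imports Complex_Main "HOL-Library.Poly_Mapping"
begin

text \<open>
  The vector space over a field with basis a type \<open>'b\<close> is \<^typ>\<open>'b \<Rightarrow>\<^sub>0 'k\<close>.
  In particular \<^typ>\<open>nat \<Rightarrow>\<^sub>0 'k\<close>, with the convolution product of
  \<^theory>\<open>HOL-Library.Poly_Mapping\<close>, is the polynomial ring in one variable (used both
  for \<open>K[x]\<close> and for \<open>K[y]\<close>).  The tensor product of the spaces with bases
  \<open>'b\<close> and \<open>'c\<close> is realised as the space with basis \<^typ>\<open>'b \<times> 'c\<close>, and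
  \<open>tensor\<close> below is its universal bilinear map.
\<close>

type_synonym 'k pol = "nat \<Rightarrow>\<^sub>0 'k"

definition scal :: "'k::field \<Rightarrow> ('b \<Rightarrow>\<^sub>0 'k) \<Rightarrow> ('b \<Rightarrow>\<^sub>0 'k)"
  where "scal c p = Poly_Mapping.map ((*) c) p"

lemma lookup_scal [simp]: "Poly_Mapping.lookup (scal c p) i = c * Poly_Mapping.lookup p i"
  unfolding scal_def by transfer (simp add: when_def)

interpretation scal: vector_space "scal :: 'k::field \<Rightarrow> ('b \<Rightarrow>\<^sub>0 'k) \<Rightarrow> ('b \<Rightarrow>\<^sub>0 'k)"
  by unfold_locales (rule poly_mapping_eqI, simp add: lookup_add algebra_simps)+

abbreviation klinear :: "(('b \<Rightarrow>\<^sub>0 'k::field) \<Rightarrow> ('c \<Rightarrow>\<^sub>0 'k)) \<Rightarrow> bool"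
  where "klinear \<equiv> Vector_Spaces.linear scal scal"

definition lin_ext :: "('b \<Rightarrow> ('c \<Rightarrow>\<^sub>0 'k::field)) \<Rightarrow> ('b \<Rightarrow>\<^sub>0 'k) \<Rightarrow> ('c \<Rightarrow>\<^sub>0 'k)"
  where "lin_ext \<phi> p = (\<Sum>b\<in>Poly_Mapping.keys p. scal (Poly_Mapping.lookup p b) (\<phi> b))"

definition basis :: "'b \<Rightarrow> ('b \<Rightarrow>\<^sub>0 'k::field)"
  where "basis b = Poly_Mapping.single b 1"

lift_definition tensor :: "('b \<Rightarrow>\<^sub>0 'k::field) \<Rightarrow> ('c \<Rightarrow>\<^sub>0 'k) \<Rightarrow> ('b \<times> 'c \<Rightarrow>\<^sub>0 'k)"
    (infixr "\<otimes>" 75)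
  is "\<lambda>p q (b, c). p b * q c"
proof -
  fix p :: "'b \<Rightarrow> 'k" and q :: "'c \<Rightarrow> 'k"
  assume "finite {b. p b \<noteq> 0}" "finite {c. q c \<noteq> 0}"
  then show "finite {bc. (case bc of (b, c) \<Rightarrow> p b * q c) \<noteq> 0}"
    by (rule_tac finite_subset[of _ "{b. p b \<noteq> 0} \<times> {c. q c \<noteq> 0}"]) auto
qed

definition tensor_map ::
  "(('b \<Rightarrow>\<^sub>0 'k::field) \<Rightarrow> ('d \<Rightarrow>\<^sub>0 'k)) \<Rightarrow> (('c \<Rightarrow>\<^sub>0 'k) \<Rightarrow> ('e \<Rightarrow>\<^sub>0 'k))
    \<Rightarrow> ('b \<times> 'c \<Rightarrow>\<^sub>0 'k) \<Rightarrow> ('d \<times> 'e \<Rightarrow>\<^sub>0 'k)"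
  where "tensor_map f g = lin_ext (\<lambda>(b, c). f (basis b) \<otimes> g (basis c))"

definition tensor_assoc :: "(('b \<times> 'c) \<times> 'd \<Rightarrow>\<^sub>0 'k::field) \<Rightarrow> ('b \<times> 'c \<times> 'd \<Rightarrow>\<^sub>0 'k)"
  where "tensor_assoc = lin_ext (\<lambda>((b, c), d). basis (b, c, d))"

definition tensor_assoc' :: "('b \<times> 'c \<times> 'd \<Rightarrow>\<^sub>0 'k::field) \<Rightarrow> (('b \<times> 'c) \<times> 'd \<Rightarrow>\<^sub>0 'k)"
  where "tensor_assoc' = lin_ext (\<lambda>(b, c, d). basis ((b, c), d))"

definition pol_mult :: "(nat \<times> nat \<Rightarrow>\<^sub>0 'k::field) \<Rightarrow> 'k pol"
  where "pol_mult = lin_ext (\<lambda>(i, j). basis i * basis j)"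

text \<open>The following facts characterise these maps on pure tensors.\<close>

lemma lookup_tensor [simp]: "Poly_Mapping.lookup (p \<otimes> q) (b, c) = Poly_Mapping.lookup p b * Poly_Mapping.lookup q c"
  by transfer simp

lemma lin_ext_superset:
  assumes "finite A" "Poly_Mapping.keys p \<subseteq> A"
  shows "lin_ext \<phi> p = (\<Sum>b\<in>A. scal (Poly_Mapping.lookup p b) (\<phi> b))"
  unfolding lin_ext_def using assms
  by (intro sum.mono_neutral_left) (auto simp: in_keys_iff)

lemma klinear_lin_ext: "klinear (lin_ext \<phi>)"
proof -
  have add: "lin_ext \<phi> (p + q) = lin_ext \<phi> p + lin_ext \<phi> q" for p q
  proof -
    let ?A = "Poly_Mapping.keys p \<union> Poly_Mapping.keys q"
    have "lin_ext \<phi> r = (\<Sum>b\<in>?A. scal (Poly_Mapping.lookup r b) (\<phi> b))" if "Poly_Mapping.keys r \<subseteq> ?A" for r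
      using that by (intro lin_ext_superset) auto
    then show ?thesis
      by (simp add: keys_add lookup_add scal.scale_left_distrib sum.distrib)
  qed
  have "lin_ext \<phi> (scal c p) = scal c (lin_ext \<phi> p)" for c p
  proof -
    have "lin_ext \<phi> (scal c p) = (\<Sum>b\<in>Poly_Mapping.keys p. scal (Poly_Mapping.lookup (scal c p) b) (\<phi> b))"
      by (intro lin_ext_superset) (auto simp: in_keys_iff)
    then show ?thesis
      by (simp add: lin_ext_def scal.scale_sum_right)
  qed
  with add show ?thesis
    by unfold_locales auto
qed

lemma lin_ext_basis [simp]: "lin_ext \<phi> (basis b) = \<phi> b"
  by (simp add: lin_ext_def basis_def)

lemma basis_tensor [simp]: "basis b \<otimes> basis c = basis (b, c)"
  by (rule poly_mapping_eqI) (auto simp: basis_def lookup_single when_def split: if_splits)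

lemma basis_expand: "p = (\<Sum>b\<in>Poly_Mapping.keys p. scal (Poly_Mapping.lookup p b) (basis b))"
  by (rule poly_mapping_eqI)
    (auto simp: lookup_sum basis_def lookup_single when_def in_keys_iff sum.delta'
      if_distrib[of "\<lambda>t. _ * t"] cong: if_cong)

lemma klinear_expand:
  assumes "klinear f"
  shows "f p = (\<Sum>b\<in>Poly_Mapping.keys p. scal (Poly_Mapping.lookup p b) (f (basis b)))"
proof -
  interpret f: Vector_Spaces.linear scal scal f by (fact assms)
  show ?thesis
    by (subst basis_expand[of p]) (simp add: f.sum f.scale)
qed

lemma lin_ext_tensor:
  "lin_ext \<phi> (p \<otimes> q)
    = (\<Sum>b\<in>Poly_Mapping.keys p. \<Sum>c\<in>Poly_Mapping.keys q. scal (Poly_Mapping.lookup p b * Poly_Mapping.lookup q c) (\<phi> (b, c)))"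
proof -
  have "lin_ext \<phi> (p \<otimes> q)
      = (\<Sum>bc\<in>Poly_Mapping.keys p \<times> Poly_Mapping.keys q. scal (Poly_Mapping.lookup (p \<otimes> q) bc) (\<phi> bc))"
    by (intro lin_ext_superset) (auto simp: in_keys_iff)
  then show ?thesis
    by (simp add: sum.cartesian_product case_prod_unfold flip: lookup_tensor)
qed

lemma tensor_sum_scal:
  "(\<Sum>b\<in>A. scal (s b) (u b)) \<otimes> (\<Sum>c\<in>B. scal (t c) (v c))
    = (\<Sum>b\<in>A. \<Sum>c\<in>B. scal (s b * t c) (u b \<otimes> v c))"
  by (rule poly_mapping_eqI) (auto simp: lookup_sum sum_product algebra_simps)

lemma tensor_map_tensor:
  assumes "klinear f" "klinear g"
  shows "tensor_map f g (p \<otimes> q) = f p \<otimes> g q"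
  unfolding klinear_expand[OF assms(1), of p] klinear_expand[OF assms(2), of q]
  by (simp add: tensor_map_def lin_ext_tensor tensor_sum_scal)

lemma pol_mult_tensor: "pol_mult (p \<otimes> q) = p * q"
proof -
  have "scal s u * scal t v = scal (s * t) (u * v)" for s t :: 'a and u v :: "'a pol"
  proof -
    have *: "scal s u = Poly_Mapping.single 0 s * u" for s :: 'a and u :: "'a pol"
      by (simp add: mult_map_scale_conv_mult scal_def)
    show ?thesis
      by (simp add: * ac_simps flip: mult_single[of 0 _ 0, simplified])
  qed
  then have "p * q = (\<Sum>b\<in>Poly_Mapping.keys p. \<Sum>c\<in>Poly_Mapping.keys q.
      scal (Poly_Mapping.lookup p b * Poly_Mapping.lookup q c) (basis b * basis c))"
    by (subst basis_expand[of p], subst basis_expand[of q]) (simp add: sum_product)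
  then show ?thesis
    by (simp add: pol_mult_def lin_ext_tensor)
qed

lemma lookup_lin_ext_inj:
  assumes "inj h"
  shows "Poly_Mapping.lookup (lin_ext (\<lambda>b. basis (h b)) t) (h b) = Poly_Mapping.lookup t b"
proof -
  have "h b' = h b \<longleftrightarrow> b' = b" for b'
    using assms by (auto dest: injD)
  then show ?thesis
    by (auto simp: lin_ext_def lookup_sum basis_def lookup_single when_def in_keys_iff
        if_distrib[of "\<lambda>t. _ * t"] cong: if_cong)
qed

lemma tensor_assoc_tensor: "tensor_assoc ((p \<otimes> q) \<otimes> r) = p \<otimes> q \<otimes> r"
proof -
  define h :: "('a \<times> 'b) \<times> 'c \<Rightarrow> 'a \<times> 'b \<times> 'c" where "h = (\<lambda>((b, c), d). (b, c, d))"
  have "inj h" and h: "h ((b, c), d) = (b, c, d)" for b c d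
    by (auto simp: inj_def h_def)
  have eq: "tensor_assoc = lin_ext (\<lambda>x. basis (h x))"
    by (simp add: tensor_assoc_def h_def case_prod_unfold)
  have "Poly_Mapping.lookup (tensor_assoc ((p \<otimes> q) \<otimes> r)) (b, c, d)
      = Poly_Mapping.lookup (p \<otimes> q \<otimes> r) (b, c, d)" for b c d
    using lookup_lin_ext_inj[OF \<open>inj h\<close>, of "(p \<otimes> q) \<otimes> r" "((b, c), d)"]
    unfolding eq h by (simp add: mult.assoc)
  then show ?thesis
    by (intro poly_mapping_eqI) auto
qed

lemma tensor_assoc'_tensor: "tensor_assoc' (p \<otimes> q \<otimes> r) = (p \<otimes> q) \<otimes> r"
proof -
  define h :: "'a \<times> 'b \<times> 'c \<Rightarrow> ('a \<times> 'b) \<times> 'c" where "h = (\<lambda>(b, c, d). ((b, c), d))"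
  have "inj h" and h: "h (b, c, d) = ((b, c), d)" for b c d
    by (auto simp: inj_def h_def)
  have eq: "tensor_assoc' = lin_ext (\<lambda>x. basis (h x))"
    by (simp add: tensor_assoc'_def h_def case_prod_unfold)
  have "Poly_Mapping.lookup (tensor_assoc' (p \<otimes> q \<otimes> r)) ((b, c), d)
      = Poly_Mapping.lookup ((p \<otimes> q) \<otimes> r) ((b, c), d)" for b c d
    using lookup_lin_ext_inj[OF \<open>inj h\<close>, of "p \<otimes> q \<otimes> r" "(b, c, d)"]
    unfolding eq h by (simp add: mult.assoc)
  then show ?thesis
    by (intro poly_mapping_eqI) auto
qed

text \<open>
  A map \<open>\<tau>\<close> from \<open>K[y] \<otimes> K[x]\<close> to \<open>K[x] \<otimes> K[y]\<close>; the monomials \<open>x\<^sup>i\<close> and \<open>y\<^sup>i\<close> are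
  both \<^term>\<open>basis i\<close>.
\<close>

type_synonym 'k twist = "(nat \<times> nat \<Rightarrow>\<^sub>0 'k) \<Rightarrow> (nat \<times> nat \<Rightarrow>\<^sub>0 'k)"

definition twisting_map :: "'k::field twist \<Rightarrow> bool"
  where "twisting_map \<tau> \<longleftrightarrow>
    klinear \<tau> \<and>
    (\<forall>f. \<tau> (1 \<otimes> f) = f \<otimes> 1) \<and>
    (\<forall>r. \<tau> (basis r \<otimes> 1) = 1 \<otimes> basis r) \<and>
    \<tau> \<circ> tensor_map id pol_mult
      = tensor_map pol_mult id \<circ> tensor_assoc' \<circ> tensor_map id \<tau> \<circ> tensor_assoc
          \<circ> tensor_map \<tau> id \<circ> tensor_assoc' \<and>
    \<tau> \<circ> tensor_map pol_mult id
      = tensor_map id pol_mult \<circ> tensor_assoc \<circ> tensor_map \<tau> id \<circ> tensor_assoc'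
          \<circ> tensor_map id \<tau> \<circ> tensor_assoc"

definition graded_twisting_map :: "'k::field twist \<Rightarrow> bool"
  where "graded_twisting_map \<tau> \<longleftrightarrow>
    twisting_map \<tau> \<and>
    (\<forall>r i. \<tau> (basis r \<otimes> basis i)
      \<in> scal.span {basis (r + i - j) \<otimes> basis j | j. j \<le> r + i})"

text \<open>
  Matrices indexed by pairs of natural numbers; addition and subtraction are pointwise,
  and the \<open>k\<close>-th row of \<open>M\<close> is \<open>M k\<close>.
\<close>

type_synonym 'k inf_matrix = "nat \<Rightarrow> nat \<Rightarrow> 'k"

definition row_finite :: "'k::zero inf_matrix \<Rightarrow> bool"
  where "row_finite M \<longleftrightarrow> (\<forall>i. finite {j. M i j \<noteq> 0})"

definition Y_matrix :: "'k::zero_neq_one inf_matrix"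
  where "Y_matrix i j = (if j = i + 1 then 1 else 0)"

definition is_matrix_of :: "'k::field inf_matrix \<Rightarrow> 'k twist \<Rightarrow> bool"
  where "is_matrix_of M \<tau> \<longleftrightarrow>
    row_finite M \<and>
    (\<forall>k. \<tau> (basis k \<otimes> basis 1)
      = (\<Sum>j = 0..k + 1. scal (M k j) (basis (k + 1 - j) \<otimes> basis j))) \<and>
    (\<forall>k j. j > k + 1 \<longrightarrow> M k j = 0)"

end

theory Submission
  imports Defs "HOL-Computational_Algebra.Polynomial"
begin

text \<open>
  Sending \<open>x\<close> to \<open>1\<close> turns row vectors into polynomials in \<open>y\<close>: the \<open>k\<close>-th row of \<open>M\<close> is the image of
  \<open>y\<^sup>k\<close> under a linear operator \<open>\<mu>\<close> on \<open>K[y]\<close>, the matrix \<open>Y\<close> is multiplication by \<open>y\<close>, and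
  the two multiplicativity laws of \<open>\<tau>\<close> become the single rule
  \<open>\<mu> (y\<^sup>k f) = (\<Sum>j. M\<^sub>k\<^sub>j y\<^sup>j \<mu>\<^bsup>k+1-j\<^esup> f)\<close>.  The rows of \<open>M - Y\<close> are the values on the monomials of
  \<open>\<delta> f = \<mu> f - y f\<close>, and the hypotheses say that \<open>\<delta> y\<^sup>k = 1 - y\<close> for \<open>k < n\<close>, whereas
  \<open>\<delta> y\<^sup>n = 1 - y + u\<close> with \<open>u \<noteq> 0\<close> of degree at most \<open>n + 1\<close>.  The claim is about the coefficients
  \<open>u\<^sub>0 = d - 1\<close>, \<open>u\<^sub>1 = c + 1\<close>, \<open>u\<^sub>n = b\<close>, \<open>u\<^sub>n\<^sub>+\<^sub>1 = a\<close>.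

  The rules for \<open>k < n\<close> give \<open>\<delta> (y\<^sup>s \<delta> f) = 0\<close> for \<open>s \<le> n - 2\<close>.  Applied to
  \<open>f = y\<^sup>n\<close> and \<open>f = 1\<close> and subtracted, they become the vanishing relations \<open>(\<Sum>j. u\<^sub>j \<delta> y\<^bsup>j+s\<^esup>) = 0\<close> (\<open>vanishing_relation\<close>).  The rule for \<open>k = n\<close>, with the powers of \<open>\<mu>\<close>
  expanded, gives a recursion for the jumps \<open>\<delta> y\<^bsup>n+r\<^esup> - \<delta> y\<^bsup>n+r-1\<^esup>\<close>, \<open>r < n\<close>, whose coefficients are
  the partial sums \<open>u\<^sub>0 + \<dots> + u\<^sub>i\<close> (\<open>jump_recursion\<close>).

  If \<open>a = 0\<close>, the vanishing relation in which only the leading term of \<open>u\<close> reaches the row \<open>n\<close> shows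
  that \<open>u\<close> has degree at most \<open>1\<close>, since otherwise \<open>u\<close> would be a multiple of \<open>1 - y\<close>; then the one for
  \<open>s = 0\<close> gives \<open>u\<^sub>0 + u\<^sub>1 = 0\<close>.
  If \<open>a \<noteq> 0\<close>, eliminating the first jump between the relation for \<open>s = 0\<close> and the recursion for \<open>r = 1\<close>
  leaves a polynomial identity in \<open>u\<close> alone.  When \<open>u\<^sub>0 + u\<^sub>1 \<noteq> 0\<close>, its coefficients determine \<open>u\<close>
  and give the second alternative.  When \<open>u\<^sub>0 + u\<^sub>1 = 0\<close>, it only shows that the coefficients of \<open>u\<close> sum to
  \<open>0\<close>; the first nonzero partial sum of index between \<open>2\<close> and \<open>n - 1\<close> would
  contradict the recursion or, through the jump it produces, a vanishing relation, so the inner coefficients vanish and \<open>b = - a\<close>.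
\<close>

section \<open>Linear maps on polynomials\<close>

lemma smult_sum_right:
  fixes g :: "'i \<Rightarrow> 'k::comm_semiring_0 poly"
  shows "smult c (sum g A) = (\<Sum>i\<in>A. smult c (g i))"
  by (induction A rule: infinite_finite_induct) (simp_all add: smult_add_right)

text \<open>Summation by diagonals; it makes the partial sums of the coefficients appear.\<close>
lemma smult_sum_triangle:
  fixes h :: "nat \<Rightarrow> 'a::comm_semiring_0 poly" and x :: "nat \<Rightarrow> 'a"
  shows "(\<Sum>j\<le>m + 1. smult (x j) (\<Sum>l<m + 1 - j. h l)) = (\<Sum>i\<le>m. smult (\<Sum>j\<le>i. x j) (h (m - i)))"
proof -
  have "(\<Sum>j\<le>m + 1. smult (x j) (\<Sum>l<m + 1 - j. h l)) = (\<Sum>j\<le>m. \<Sum>l\<le>m - j. smult (x j) (h l))"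
    by (simp add: Suc_diff_le lessThan_Suc_atMost smult_sum_right)
  also have "\<dots> = (\<Sum>l\<le>m. \<Sum>j\<le>m - l. smult (x j) (h l))"
    unfolding sum.Sigma[OF finite_atMost ballI[OF finite_atMost]]
    by (rule sum.reindex_bij_witness[of _ prod.swap prod.swap]) auto
  also have "\<dots> = (\<Sum>i\<le>m. \<Sum>j\<le>i. smult (x j) (h (m - i)))"
    by (rule sum.reindex_bij_witness[of _ "\<lambda>i. m - i" "\<lambda>i. m - i"]) auto
  finally show ?thesis by (simp add: smult_sum)
qed

text \<open>The right-hand side of the commutation rule for a row equal to \<open>1 - y\<close> has two terms only.\<close>
lemma sum_coeff_one_minus_y:
  fixes g :: "nat \<Rightarrow> 'a::comm_ring_1 poly"
  assumes "m \<ge> 1"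
  shows "(\<Sum>j\<le>m. smult (coeff (1 - monom 1 1) j) (g j)) = g 0 - g 1"
proof -
  have "(\<Sum>j\<le>m. smult (coeff (1 - monom 1 1) j) (g j)) = (\<Sum>j\<in>{0,1}. smult (coeff (1 - monom 1 1) j) (g j))"
    using assms by (intro sum.mono_neutral_right) (auto simp: coeff_1)
  then show ?thesis by (simp add: coeff_1)
qed

lemma coeff_mult_monom_1:
  "coeff (p * monom 1 (Suc 0)) j = (if j = 0 then 0 else coeff p (j - 1))" for p :: "'a::comm_semiring_1 poly"
  by (subst mult.commute) (simp add: coeff_monom_mult)

definition row_operator :: "(nat \<Rightarrow> 'k::field poly) \<Rightarrow> 'k poly \<Rightarrow> 'k poly"
  where "row_operator R f = (\<Sum>k\<le>degree f. smult (coeff f k) (R k))"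

lemma row_operator_bound:
  assumes "degree f \<le> N"
  shows "row_operator R f = (\<Sum>k\<le>N. smult (coeff f k) (R k))"
  unfolding row_operator_def using assms
  by (intro sum.mono_neutral_left) (auto simp: coeff_eq_0)

lemma row_operator_add: "row_operator R (f + g) = row_operator R f + row_operator R g"
  using row_operator_bound[of f "max (degree f) (degree g)" R]
    row_operator_bound[of g "max (degree f) (degree g)" R]
    row_operator_bound[OF degree_add_le_max, of R f g]
  by (simp add: smult_add_left sum.distrib)

lemma row_operator_smult: "row_operator R (smult c f) = smult c (row_operator R f)"
  using row_operator_bound[OF degree_smult_le, of R c f]
  by (simp add: row_operator_def smult_sum_right)

lemma row_operator_monom: "row_operator R (monom 1 k) = R k"
proof -
  have "row_operator R (monom 1 k) = (\<Sum>i\<le>k. if i = k then R k else 0)"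
    by (simp add: row_operator_def degree_monom_eq if_distrib[of "\<lambda>c. smult c _"] eq_commute cong: if_cong)
  then show ?thesis by simp
qed

lemma additive_poly_eqI:
  fixes F G :: "'k::field poly \<Rightarrow> 'k poly"
  assumes "\<And>f g. F (f + g) = F f + F g" "\<And>c f. F (smult c f) = smult c (F f)"
    and "\<And>f g. G (f + g) = G f + G g" "\<And>c f. G (smult c f) = smult c (G f)"
    and "\<And>k. F (monom 1 k) = G (monom 1 k)"
  shows "F f = G f"
proof -
  have 0: "F 0 = 0" "G 0 = 0"
    using assms(2)[of 0 0] assms(4)[of 0 0] by simp_all
  have "F (\<Sum>i\<in>A. smult (coeff f i) (monom 1 i)) = G (\<Sum>i\<in>A. smult (coeff f i) (monom 1 i))" for A
    by (induction A rule: infinite_finite_induct) (simp_all add: 0 assms)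
  from this[of "{..degree f}"] show ?thesis
    by (simp add: smult_monom poly_as_sum_of_monoms)
qed

section \<open>From the twisting map to an operator on polynomials\<close>

abbreviation linear_to_poly :: "(('b \<Rightarrow>\<^sub>0 'k::field) \<Rightarrow> 'k poly) \<Rightarrow> bool"
  where "linear_to_poly \<equiv> Vector_Spaces.linear scal smult"

lemma linear_to_polyI:
  fixes F :: "('b \<Rightarrow>\<^sub>0 'k::field) \<Rightarrow> 'k poly"
  assumes "\<And>p q. F (p + q) = F p + F q" "\<And>c p. F (scal c p) = smult c (F p)"
  shows "linear_to_poly F"
  by unfold_locales (simp_all add: assms smult_add_left smult_add_right)

lemma linear_to_poly_eqI:
  fixes F G :: "('b \<Rightarrow>\<^sub>0 'k::field) \<Rightarrow> 'k poly"
  assumes "linear_to_poly F" "linear_to_poly G" "\<And>b. F (basis b) = G (basis b)"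
  shows "F p = G p"
proof -
  interpret F: Vector_Spaces.linear scal smult F by fact
  interpret G: Vector_Spaces.linear scal smult G by fact
  show ?thesis
    by (subst (1 2) basis_expand[of p]) (simp add: F.sum F.scale G.sum G.scale assms(3))
qed

text \<open>
  The linear map \<open>K[x] \<otimes> K[y] \<rightarrow> K[y]\<close> with \<open>x \<mapsto> 1\<close>.  Gradedness makes it harmless: the power of \<open>x\<close> in
  a homogeneous element can be recovered from the power of \<open>y\<close>.
\<close>
definition x_to_one :: "(nat \<times> nat \<Rightarrow>\<^sub>0 'k::field) \<Rightarrow> 'k poly"
  where "x_to_one t = (\<Sum>b\<in>Poly_Mapping.keys t. monom (Poly_Mapping.lookup t b) (snd b))"

lemma x_to_one_superset:
  assumes "finite A" "Poly_Mapping.keys t \<subseteq> A"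
  shows "x_to_one t = (\<Sum>b\<in>A. monom (Poly_Mapping.lookup t b) (snd b))"
  unfolding x_to_one_def using assms
  by (intro sum.mono_neutral_left) (auto simp: in_keys_iff)

lemma linear_x_to_one: "linear_to_poly x_to_one"
proof (rule linear_to_polyI)
  fix p q :: "nat \<times> nat \<Rightarrow>\<^sub>0 'k::field" and c :: 'k
  let ?A = "Poly_Mapping.keys p \<union> Poly_Mapping.keys q"
  have "x_to_one r = (\<Sum>b\<in>?A. monom (Poly_Mapping.lookup r b) (snd b))"
    if "Poly_Mapping.keys r \<subseteq> ?A" for r :: "nat \<times> nat \<Rightarrow>\<^sub>0 'k"
    using that by (intro x_to_one_superset) auto
  then show "x_to_one (p + q) = x_to_one p + x_to_one q"
    by (simp add: keys_add lookup_add add_monom[symmetric] sum.distrib)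
  have "x_to_one (scal c p) = (\<Sum>b\<in>Poly_Mapping.keys p. monom (Poly_Mapping.lookup (scal c p) b) (snd b))"
    by (intro x_to_one_superset) (auto simp: in_keys_iff)
  then show "x_to_one (scal c p) = smult c (x_to_one p)"
    by (simp add: x_to_one_def smult_sum_right smult_monom)
qed

lemma x_to_one_basis [simp]: "x_to_one (basis (i, j)) = monom 1 j"
  by (simp add: x_to_one_def basis_def)

lemma klinear_tensor_left: "klinear (\<lambda>p. p \<otimes> q)"
  by unfold_locales (rule poly_mapping_eqI, auto simp: lookup_add algebra_simps)+

lemma klinear_tensor_right: "klinear (\<lambda>q. p \<otimes> q)"
  by unfold_locales (rule poly_mapping_eqI, auto simp: lookup_add algebra_simps)+

lemma basis_mult: "basis i * basis j = basis (i + j)"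
  by (simp add: basis_def mult_single)

lemma basis_0: "basis (0 :: nat) = 1"
  by (simp add: basis_def)

lemma klinear_id: "klinear id"
  by unfold_locales auto

lemma klinear_tensor_map: "klinear (tensor_map f g)"
  and klinear_assoc: "klinear tensor_assoc"
  and klinear_assoc': "klinear tensor_assoc'"
  and klinear_pol_mult: "klinear pol_mult"
  unfolding tensor_map_def tensor_assoc_def tensor_assoc'_def pol_mult_def by (rule klinear_lin_ext)+

context
  fixes \<tau> :: "'k::field twist" and \<mu> :: "'k poly \<Rightarrow> 'k poly"
  assumes twisting: "twisting_map \<tau>"
  defines "\<mu> \<equiv> row_operator (\<lambda>k. x_to_one (\<tau> (basis (k, 1))))"
begin

lemma klinear_tau: "klinear \<tau>"
  using twisting by (simp add: twisting_map_def)

lemma linear_mu_x_to_one: "linear_to_poly (\<lambda>t. \<mu> (x_to_one t))"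
proof -
  interpret e: Vector_Spaces.linear scal smult x_to_one by (rule linear_x_to_one)
  show ?thesis
    by (rule linear_to_polyI) (simp_all add: \<mu>_def e.add e.scale row_operator_add row_operator_smult)
qed

text \<open>
  Multiplicativity of \<open>\<tau>\<close> in \<open>x\<close>: moving \<open>y\<^sup>r\<close> past one more factor \<open>x\<close> applies \<open>\<tau>\<close> to the
  \<open>K[y]\<close>-part of what is already there, and the powers of \<open>x\<close> collected on the left disappear for
  \<open>x = 1\<close>.
\<close>
lemma twist_power_x: "x_to_one (\<tau> (basis (r, i))) = (\<mu> ^^ i) (monom 1 r)"
proof (induction i)
  case 0
  have "\<tau> (basis (r, 0)) = 1 \<otimes> basis r"
    using twisting by (simp add: twisting_map_def flip: basis_0)
  then show ?case by (simp flip: basis_0)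
next
  case (Suc i)
  have "\<tau> (tensor_map id pol_mult (basis r \<otimes> basis i \<otimes> basis 1))
    = tensor_map pol_mult id (tensor_assoc' (tensor_map id \<tau> (tensor_assoc
          (tensor_map \<tau> id (tensor_assoc' (basis r \<otimes> basis i \<otimes> basis 1))))))"
    using twisting unfolding twisting_map_def comp_def by metis
  then have "\<tau> (basis (r, Suc i)) = tensor_map pol_mult id (tensor_assoc' (tensor_map id \<tau> (tensor_assoc
          (\<tau> (basis (r, i)) \<otimes> basis 1))))"
    unfolding tensor_assoc'_tensor
    by (simp add: tensor_map_tensor klinear_id klinear_pol_mult klinear_tau pol_mult_tensor basis_mult
        flip: basis_tensor)
  moreover have "x_to_one (tensor_map pol_mult id (tensor_assoc' (tensor_map id \<tau> (tensor_assoc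
          (t \<otimes> basis 1))))) = \<mu> (x_to_one t)" (is "?F t = _") for t
  proof (rule linear_to_poly_eqI[of ?F])
    show "linear_to_poly ?F"
      using Vector_Spaces.linear_compose[OF klinear_tensor_left Vector_Spaces.linear_compose[OF klinear_assoc
         Vector_Spaces.linear_compose[OF klinear_tensor_map
         Vector_Spaces.linear_compose[OF klinear_assoc'
         Vector_Spaces.linear_compose[OF klinear_tensor_map linear_x_to_one]]]]]
      by (simp add: comp_def)
    show "linear_to_poly (\<lambda>t. \<mu> (x_to_one t))" by (rule linear_mu_x_to_one)
    fix b :: "nat \<times> nat"
    obtain p q where b: "b = (p, q)" by (cases b)
    have "x_to_one (tensor_map pol_mult id (tensor_assoc' (basis p \<otimes> s))) = x_to_one s"
      (is "?G s = _") for s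
    proof (rule linear_to_poly_eqI[of ?G])
      show "linear_to_poly ?G"
        using Vector_Spaces.linear_compose[OF klinear_tensor_right
         Vector_Spaces.linear_compose[OF klinear_assoc'
         Vector_Spaces.linear_compose[OF klinear_tensor_map linear_x_to_one]]]
        by (simp add: comp_def)
      show "linear_to_poly x_to_one" by (rule linear_x_to_one)
      fix b' :: "nat \<times> nat"
      obtain i j where "b' = (i, j)" by (cases b')
      then show "?G (basis b') = x_to_one (basis b')"
        by (simp add: tensor_assoc'_def tensor_map_def basis_mult pol_mult_def)
    qed
    moreover have "tensor_map id \<tau> (tensor_assoc (basis b \<otimes> basis 1)) = basis p \<otimes> \<tau> (basis (q, 1))"
      by (simp add: b tensor_assoc_def tensor_map_def)
    ultimately have "?F (basis b) = x_to_one (\<tau> (basis (q, 1)))"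
      by (simp only:)
    then show "?F (basis b) = \<mu> (x_to_one (basis b))"
      by (simp only: b x_to_one_basis \<mu>_def row_operator_monom)
  qed
  ultimately show ?case using Suc by simp
qed

text \<open>
  Multiplicativity of \<open>\<tau>\<close> in \<open>y\<close>: in \<open>y\<^sup>r y\<^sup>k x\<close>, first move \<open>y\<^sup>k\<close> past \<open>x\<close>, then move \<open>y\<^sup>r\<close> past the
  resulting \<open>x\<^bsup>k+1-j\<^esup>\<close>, which by \<open>twist_power_x\<close> costs \<open>k + 1 - j\<close> applications of \<open>\<mu>\<close>.
\<close>
lemma twist_power_y:
  assumes M: "is_matrix_of M \<tau>"
  shows "\<mu> (monom 1 (r + k)) = (\<Sum>j\<le>k + 1. smult (M k j) (monom 1 j * (\<mu> ^^ (k + 1 - j)) (monom 1 r)))"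
proof -
  have "\<tau> (tensor_map pol_mult id ((basis r \<otimes> basis k) \<otimes> basis 1))
    = tensor_map id pol_mult (tensor_assoc (tensor_map \<tau> id (tensor_assoc'
          (tensor_map id \<tau> (tensor_assoc ((basis r \<otimes> basis k) \<otimes> basis 1))))))"
    using twisting unfolding twisting_map_def comp_def by metis
  then have 1: "\<tau> (basis (r + k, 1)) = tensor_map id pol_mult (tensor_assoc (tensor_map \<tau> id (tensor_assoc'
          (basis r \<otimes> \<tau> (basis k \<otimes> basis 1)))))"
    unfolding tensor_assoc_tensor
    by (simp add: tensor_map_tensor klinear_id klinear_pol_mult klinear_tau pol_mult_tensor basis_mult
        flip: basis_tensor)
  define F where "F t = x_to_one (tensor_map id pol_mult (tensor_assoc (tensor_map \<tau> id (tensor_assoc'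
          (basis r \<otimes> t)))))" for t
  have lin: "linear_to_poly F"
    using Vector_Spaces.linear_compose[OF klinear_tensor_right Vector_Spaces.linear_compose[OF klinear_assoc'
         Vector_Spaces.linear_compose[OF klinear_tensor_map
         Vector_Spaces.linear_compose[OF klinear_assoc
         Vector_Spaces.linear_compose[OF klinear_tensor_map linear_x_to_one]]]]]
    by (simp add: comp_def F_def[abs_def])
  have F_basis: "F (basis (i, j)) = monom 1 j * (\<mu> ^^ i) (monom 1 r)" for i j
  proof -
    have "x_to_one (tensor_map id pol_mult (tensor_assoc (s \<otimes> basis j))) = monom 1 j * x_to_one s"
      (is "?G s = _") for s :: "nat \<times> nat \<Rightarrow>\<^sub>0 'k"
    proof (rule linear_to_poly_eqI[of ?G])
      show "linear_to_poly ?G"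
        using Vector_Spaces.linear_compose[OF klinear_tensor_left
         Vector_Spaces.linear_compose[OF klinear_assoc
         Vector_Spaces.linear_compose[OF klinear_tensor_map linear_x_to_one]]]
        by (simp add: comp_def)
      interpret e: Vector_Spaces.linear scal smult "x_to_one :: _ \<Rightarrow> 'k poly" by (rule linear_x_to_one)
      show "linear_to_poly (\<lambda>s :: nat \<times> nat \<Rightarrow>\<^sub>0 'k. monom 1 j * x_to_one s)"
        by (rule linear_to_polyI) (simp_all add: e.add e.scale distrib_left)
      fix b' :: "nat \<times> nat"
      obtain p q where "b' = (p, q)" by (cases b')
      then show "?G (basis b') = monom 1 j * x_to_one (basis b')"
        by (simp add: tensor_assoc_def tensor_map_def basis_mult pol_mult_def mult_monom add.commute)
    qed
    moreover have "tensor_map \<tau> id (tensor_assoc' (basis r \<otimes> basis (i, j))) = \<tau> (basis (r, i)) \<otimes> basis j"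
      by (simp add: tensor_assoc'_def tensor_map_def)
    ultimately show ?thesis
      by (simp add: F_def twist_power_x)
  qed
  interpret F: Vector_Spaces.linear scal smult F by (rule lin)
  have "\<mu> (monom 1 (r + k)) = F (\<tau> (basis k \<otimes> basis 1))"
    using 1 by (simp add: \<mu>_def row_operator_monom F_def)
  also have "\<tau> (basis k \<otimes> basis 1) = (\<Sum>j\<le>k + 1. scal (M k j) (basis (k + 1 - j, j)))"
    using M by (simp add: is_matrix_of_def atMost_atLeast0)
  finally show ?thesis
    by (simp only: F.sum F.scale F_basis)
qed

text \<open>
  For \<open>f = y\<^sup>r\<close> this is the \<open>r\<close>-th row of \<open>Y\<^sup>k M = (\<Sum>j. M\<^sub>k\<^sub>j M\<^bsup>k+1-j\<^esup> Y\<^sup>j)\<close>: matrices act on row vectors from the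
  right, which reverses the order of the factors.
\<close>
lemma twist_commutation:
  assumes M: "is_matrix_of M \<tau>"
  shows "\<mu> (monom 1 k * f) = (\<Sum>j\<le>k + 1. smult (M k j) (monom 1 j * (\<mu> ^^ (k + 1 - j)) f))"
proof (rule additive_poly_eqI[where f = f])
  have add: "(\<mu> ^^ i) (g + h) = (\<mu> ^^ i) g + (\<mu> ^^ i) h" for i g h
    by (induction i) (simp_all add: \<mu>_def row_operator_add)
  have scale: "(\<mu> ^^ i) (smult s g) = smult s ((\<mu> ^^ i) g)" for i s g
    by (induction i) (simp_all add: \<mu>_def row_operator_smult)
  show "\<mu> (monom 1 k * (g + h)) = \<mu> (monom 1 k * g) + \<mu> (monom 1 k * h)" for g h
    by (simp add: \<mu>_def row_operator_add distrib_left)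
  show "\<mu> (monom 1 k * smult s g) = smult s (\<mu> (monom 1 k * g))" for s g
    by (simp add: \<mu>_def row_operator_smult)
  show "(\<Sum>j\<le>k + 1. smult (M k j) (monom 1 j * (\<mu> ^^ (k + 1 - j)) (g + h)))
      = (\<Sum>j\<le>k + 1. smult (M k j) (monom 1 j * (\<mu> ^^ (k + 1 - j)) g))
        + (\<Sum>j\<le>k + 1. smult (M k j) (monom 1 j * (\<mu> ^^ (k + 1 - j)) h))" for g h
    unfolding add distrib_left smult_add_right sum.distrib ..
  show "(\<Sum>j\<le>k + 1. smult (M k j) (monom 1 j * (\<mu> ^^ (k + 1 - j)) (smult s g)))
      = smult s (\<Sum>j\<le>k + 1. smult (M k j) (monom 1 j * (\<mu> ^^ (k + 1 - j)) g))" for s g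
    unfolding scale smult_sum_right by (simp only: mult_smult_right smult_smult mult.commute)
  show "\<mu> (monom 1 k * monom 1 r)
      = (\<Sum>j\<le>k + 1. smult (M k j) (monom 1 j * (\<mu> ^^ (k + 1 - j)) (monom 1 r)))" for r
    using twist_power_y[OF M, of r k] by (simp only: mult_monom mult_1_right add.commute)
qed

lemma mu_monom:
  assumes M: "is_matrix_of M \<tau>"
  shows "\<mu> (monom 1 k) = (\<Sum>j\<le>k + 1. monom (M k j) j)"
proof -
  interpret e: Vector_Spaces.linear scal smult "x_to_one :: _ \<Rightarrow> 'k poly" by (rule linear_x_to_one)
  have "\<tau> (basis k \<otimes> basis 1) = (\<Sum>j\<le>k + 1. scal (M k j) (basis (k + 1 - j, j)))"
    using M by (simp add: is_matrix_of_def atMost_atLeast0)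
  then have "\<mu> (monom 1 k) = x_to_one (\<Sum>j\<le>k + 1. scal (M k j) (basis (k + 1 - j, j)))"
    by (simp add: \<mu>_def row_operator_monom)
  then show ?thesis
    by (simp only: e.sum e.scale x_to_one_basis smult_monom mult_1_right)
qed

lemma coeff_mu_monom:
  assumes M: "is_matrix_of M \<tau>"
  shows "coeff (\<mu> (monom 1 k)) j = M k j"
  using M by (auto simp: mu_monom[OF M] coeff_sum is_matrix_of_def simp del: sum.atMost_Suc)

end

section \<open>Operators that satisfy the commutation rule\<close>

locale commutation_operator =
  fixes \<mu> :: "'k::field poly \<Rightarrow> 'k poly"
  assumes mu_add: "\<mu> (f + g) = \<mu> f + \<mu> g"
    and mu_smult: "\<mu> (smult c f) = smult c (\<mu> f)"
    and degree_mu_monom: "degree (\<mu> (monom 1 k)) \<le> k + 1"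
    and mu_monom_mult: "\<mu> (monom 1 k * f)
      = (\<Sum>j\<le>k + 1. smult (coeff (\<mu> (monom 1 k)) j) (monom 1 j * (\<mu> ^^ (k + 1 - j)) f))"
begin

text \<open>The action of \<open>M - Y\<close> on row vectors.\<close>
definition \<delta> :: "'k poly \<Rightarrow> 'k poly"
  where "\<delta> f = \<mu> f - monom 1 1 * f"

lemma delta_add: "\<delta> (f + g) = \<delta> f + \<delta> g"
  by (simp add: \<delta>_def mu_add algebra_simps)

lemma delta_smult: "\<delta> (smult c f) = smult c (\<delta> f)"
  by (simp add: \<delta>_def mu_smult smult_diff_right)

lemma delta_0 [simp]: "\<delta> 0 = 0"
  using delta_smult[of 0 0] by simp

lemma delta_minus: "\<delta> (- f) = - \<delta> f"
  using delta_smult[of "-1" f] by simp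

lemma delta_diff: "\<delta> (f - g) = \<delta> f - \<delta> g"
  using delta_add[of f "- g"] by (simp add: delta_minus)

lemma delta_sum: "\<delta> (sum f A) = (\<Sum>i\<in>A. \<delta> (f i))"
  by (induction A rule: infinite_finite_induct) (simp_all add: delta_add)

lemma mu_eq: "\<mu> f = monom 1 1 * f + \<delta> f"
  by (simp add: \<delta>_def)

lemma degree_delta_monom: "degree (\<delta> (monom 1 k)) \<le> k + 1"
proof -
  have "degree (monom 1 1 * monom 1 k :: 'k poly) \<le> k + 1"
    by (simp add: mult_monom degree_monom_eq)
  then show ?thesis
    unfolding \<delta>_def using degree_mu_monom by (intro degree_diff_le) auto
qed

text \<open>
  The superdiagonal entry \<open>1\<close> of \<open>Y\<close> contributes \<open>y\<^bsup>k+1\<^esup> f\<close> to the commutation rule, on both sides, so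
  the rule persists when row \<open>k\<close> of \<open>M\<close> is replaced by row \<open>k\<close> of \<open>M - Y\<close>.
\<close>
lemma delta_monom_mult:
  "\<delta> (monom 1 k * f)
    = (\<Sum>j\<le>k + 1. smult (coeff (\<delta> (monom 1 k)) j) (monom 1 j * (\<mu> ^^ (k + 1 - j)) f))"
proof -
  have co: "coeff (\<mu> (monom 1 k)) j = coeff (\<delta> (monom 1 k)) j + (if j = k + 1 then 1 else 0)" for j
    by (simp add: mu_eq mult_monom)
  have "\<mu> (monom 1 k * f) = (\<Sum>j\<le>k + 1. smult (coeff (\<delta> (monom 1 k)) j) (monom 1 j * (\<mu> ^^ (k + 1 - j)) f))
     + (\<Sum>j\<le>k + 1. if j = k + 1 then monom 1 (k + 1) * f else 0)"
    unfolding mu_monom_mult co smult_add_left sum.distrib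
    by (intro arg_cong2[where f = "(+)"] sum.cong) auto
  also have "(\<Sum>j\<le>k + 1. if j = k + 1 then monom 1 (k + 1) * f else 0) = monom 1 (k + 1) * f"
    by simp
  finally show ?thesis
    by (simp add: \<delta>_def mult_monom flip: mult.assoc)
qed

end

section \<open>Consequences of the commutation rule up to the first exceptional row\<close>

text \<open>The polynomial \<open>u\<close> is the deviation of row \<open>n\<close> from the rows before it.\<close>
locale first_exceptional_row = commutation_operator +
  fixes n :: nat and u :: "'a poly"
  assumes n_ge_2: "n \<ge> 2"
    and delta_monom_less: "k < n \<Longrightarrow> \<delta> (monom 1 k) = 1 - monom 1 1"
    and delta_monom_n: "\<delta> (monom 1 n) = 1 - monom 1 1 + u"
    and u_nonzero: "u \<noteq> 0"
begin

lemma degree_u: "degree u \<le> n + 1"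
proof -
  have "degree (1 - monom 1 1 :: 'a poly) \<le> n + 1"
    by (intro degree_diff_le) (auto simp: degree_monom_eq)
  then have "degree (\<delta> (monom 1 n) - (1 - monom 1 1)) \<le> n + 1"
    using degree_delta_monom[of n] by (simp add: degree_diff_le del: One_nat_def)
  then show ?thesis by (simp add: delta_monom_n)
qed

lemma coeff_u_beyond: "j > n + 1 \<Longrightarrow> coeff u j = 0"
  using degree_u by (intro coeff_eq_0) auto

lemma u_expand: "u = (\<Sum>j\<le>n + 1. smult (coeff u j) (monom 1 j))"
  using poly_as_sum_of_monoms'[OF degree_u] by (simp add: smult_monom)

lemma delta_monom_mult_less:
  assumes "k < n"
  shows "\<delta> (monom 1 k * f) = \<delta> ((\<mu> ^^ k) f)"
  using assms
  by (simp only: delta_monom_mult delta_monom_less sum_coeff_one_minus_y[of "k + 1"]) (simp add: \<delta>_def)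

text \<open>
  The contribution of \<open>u\<close> to the commutation rule of row \<open>n\<close>: for \<open>u = 0\<close> that rule would have the
  form of \<open>delta_monom_mult_less\<close>.
\<close>
definition defect :: "'a poly \<Rightarrow> 'a poly"
  where "defect f = (\<Sum>j\<le>n + 1. smult (coeff u j) (monom 1 j * (\<mu> ^^ (n + 1 - j)) f))"

lemma delta_monom_mult_n: "\<delta> (monom 1 n * f) = \<delta> ((\<mu> ^^ n) f) + defect f"
  by (simp only: delta_monom_mult delta_monom_n coeff_add smult_add_left sum.distrib
      sum_coeff_one_minus_y[of "n + 1"] defect_def[symmetric]) (simp add: \<delta>_def sum_coeff_one_minus_y)

text \<open>The powers of \<open>\<mu> = y + \<delta>\<close> expand with one \<open>\<delta>\<close> only, because \<open>\<delta> \<mu>\<^sup>l f = \<delta> (y\<^sup>l f)\<close> for \<open>l < n\<close>.\<close>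
lemma mu_power:
  assumes "k \<le> n"
  shows "(\<mu> ^^ k) f = monom 1 k * f + (\<Sum>l<k. monom 1 (k - 1 - l) * \<delta> (monom 1 l * f))"
  using assms
proof (induction k)
  case 0
  then show ?case by (simp add: one_pCons monom_0)
next
  case (Suc k)
  have "(\<mu> ^^ Suc k) f = monom 1 1 * (\<mu> ^^ k) f + \<delta> (monom 1 k * f)"
    using Suc.prems by (simp add: mu_eq delta_monom_mult_less)
  also have "monom 1 1 * (\<mu> ^^ k) f = monom 1 (Suc k) * f + (\<Sum>l<k. monom 1 (k - l) * \<delta> (monom 1 l * f))"
    using Suc by (simp add: algebra_simps sum_distrib_left mult_monom flip: mult.assoc)
      (intro sum.cong; simp add: Suc_diff_Suc)
  finally show ?case
    by (simp add: one_pCons monom_0 add.assoc)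
qed

lemma delta_mu_power:
  assumes "k \<le> n"
  shows "\<delta> ((\<mu> ^^ k) f) = \<delta> (monom 1 k * f)
    + (\<Sum>l<k. \<delta> (monom 1 (k - 1 - l) * \<delta> (monom 1 l * f)))"
  unfolding mu_power[OF assms] by (simp add: delta_add delta_sum)

text \<open>
  Both \<open>\<delta> \<mu>\<^bsup>s+1\<^esup> f\<close> and the \<open>\<delta>\<close> of its leading term \<open>y\<^bsup>s+1\<^esup> f\<close> are the same, so the remaining terms in
  \<open>delta_mu_power\<close> sum to zero; all but the one with \<open>l = 0\<close> vanish by induction.
\<close>
lemma delta_monom_delta:
  assumes "s + 1 < n"
  shows "\<delta> (monom 1 s * \<delta> f) = 0"
  using assms
proof (induction s arbitrary: f rule: less_induct)
  case (less s)
  have "(\<Sum>l<s + 1. \<delta> (monom 1 (s - l) * \<delta> (monom 1 l * f))) = 0"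
    using delta_mu_power[of "s + 1" f] delta_monom_mult_less[of "s + 1" f] less.prems by simp
  also have "(\<Sum>l<s + 1. \<delta> (monom 1 (s - l) * \<delta> (monom 1 l * f)))
      = (\<Sum>l\<in>{0}. \<delta> (monom 1 (s - l) * \<delta> (monom 1 l * f)))"
    using less by (intro sum.mono_neutral_right) auto
  finally show ?case by (simp add: monom_0 flip: one_pCons)
qed

text \<open>
  For the exponent \<open>n\<close> the last term, \<open>s = n - 1\<close>, is outside the range of \<open>delta_monom_delta\<close> and survives.
\<close>
lemma delta_mu_power_n: "\<delta> ((\<mu> ^^ n) f) = \<delta> (monom 1 n * f) + \<delta> (monom 1 (n - 1) * \<delta> f)"
proof -
  have "(\<Sum>l<n. \<delta> (monom 1 (n - 1 - l) * \<delta> (monom 1 l * f)))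
      = (\<Sum>l\<in>{0}. \<delta> (monom 1 (n - 1 - l) * \<delta> (monom 1 l * f)))"
    using n_ge_2 by (intro sum.mono_neutral_right) (auto intro!: delta_monom_delta)
  then show ?thesis
    by (simp add: delta_mu_power monom_0 flip: one_pCons)
qed

definition psum :: "nat \<Rightarrow> 'a"
  where "psum i = (\<Sum>j\<le>i. coeff u j)"

lemma psum_Suc: "psum (Suc i) = psum i + coeff u (Suc i)"
  by (simp add: psum_def)

text \<open>
  The summands of the defect.  The power \<open>\<mu>\<^bsup>n+1\<^esup>\<close> for \<open>j = 0\<close> is one beyond the range of \<open>mu_power\<close>, whence
  the extra term.
\<close>
lemma monom_mult_mu_power:
  assumes "j \<le> n + 1"
  shows "monom 1 j * (\<mu> ^^ (n + 1 - j)) f = monom 1 (n + 1) * f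
    + (\<Sum>l<n + 1 - j. monom 1 (n - l) * \<delta> (monom 1 l * f))
    + (if j = 0 then \<delta> (monom 1 (n - 1) * \<delta> f) else 0)"
proof (cases j)
  case 0
  have "(\<mu> ^^ (n + 1)) f = monom 1 1 * (\<mu> ^^ n) f + \<delta> ((\<mu> ^^ n) f)"
    by (simp add: mu_eq)
  also have "monom 1 1 * (\<mu> ^^ n) f = monom 1 (n + 1) * f + (\<Sum>l<n. monom 1 (n - l) * \<delta> (monom 1 l * f))"
    by (simp add: mu_power algebra_simps sum_distrib_left mult_monom flip: mult.assoc)
      (intro sum.cong; simp add: Suc_diff_Suc)
  finally show ?thesis
    using 0 by (simp add: delta_mu_power_n monom_0 add.assoc flip: one_pCons)
next
  case (Suc i)
  with assms have "i \<le> n" by simp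
  have "monom 1 j * (\<mu> ^^ (n - i)) f = monom 1 (n + 1) * f
    + (\<Sum>l<n - i. monom 1 (j + (n - i - 1 - l)) * \<delta> (monom 1 l * f))"
    using Suc \<open>i \<le> n\<close>
    by (simp add: mu_power distrib_left sum_distrib_left mult_monom flip: mult.assoc)
  also have "(\<Sum>l<n - i. monom 1 (j + (n - i - 1 - l)) * \<delta> (monom 1 l * f))
    = (\<Sum>l<n - i. monom 1 (n - l) * \<delta> (monom 1 l * f))"
    using Suc by (intro sum.cong) (auto intro!: arg_cong2[where f = "(*)"] arg_cong2[where f = monom])
  finally show ?thesis using Suc by simp
qed

text \<open>
  The commutation rule of row \<open>n\<close> says that the defect is \<open>- \<delta> (y\<^bsup>n-1\<^esup> \<delta> f)\<close>; expanding the defect and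
  summing by diagonals gives an identity that contains \<open>\<delta>\<close> but no power of \<open>\<mu>\<close>.
\<close>
lemma defect_identity:
  "smult (1 + coeff u 0) (\<delta> (monom 1 (n - 1) * \<delta> f)) + smult (psum (n + 1)) (monom 1 (n + 1) * f)
    + (\<Sum>i\<le>n. smult (psum i) (monom 1 i * \<delta> (monom 1 (n - i) * f))) = 0"
proof -
  have "defect f = (\<Sum>j\<le>n + 1. smult (coeff u j) (monom 1 (n + 1) * f)
      + smult (coeff u j) (\<Sum>l<n + 1 - j. monom 1 (n - l) * \<delta> (monom 1 l * f))
      + (if j = 0 then smult (coeff u 0) (\<delta> (monom 1 (n - 1) * \<delta> f)) else 0))"
    unfolding defect_def by (intro sum.cong refl) (subst monom_mult_mu_power; auto simp: smult_add_right)
  also have "\<dots> = smult (psum (n + 1)) (monom 1 (n + 1) * f)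
      + (\<Sum>i\<le>n. smult (psum i) (monom 1 i * \<delta> (monom 1 (n - i) * f)))
      + smult (coeff u 0) (\<delta> (monom 1 (n - 1) * \<delta> f))"
    unfolding sum.distrib smult_sum_triangle by (simp add: psum_def smult_sum smult_add_left)
  finally show ?thesis
    using delta_monom_mult_n[of f] delta_mu_power_n[of f] by (simp add: smult_add_left algebra_simps)
qed

definition jump :: "nat \<Rightarrow> 'a poly"
  where "jump i = \<delta> (monom 1 (n + i)) - \<delta> (monom 1 (n + i - 1))"

lemma jump_0: "jump 0 = u"
  using n_ge_2 by (simp add: jump_def delta_monom_n delta_monom_less)

lemma delta_step:
  assumes "1 \<le> m"
  shows "\<delta> (monom 1 (m - 1) * (monom 1 1 - 1)) = \<delta> (monom 1 m) - \<delta> (monom 1 (m - 1))"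
  using assms by (simp add: algebra_simps mult_monom delta_diff)

text \<open>
  The polynomial \<open>f = y\<^bsup>r-1\<^esup> (y - 1)\<close> satisfies \<open>\<delta> f = 0\<close>, because the rows \<open>r - 1\<close> and \<open>r\<close> agree; this
  removes the first term of \<open>defect_identity\<close> and turns the others into jumps.
\<close>
lemma jump_recursion:
  assumes "1 \<le> r" "r < n"
  shows "smult (- coeff u 0) (jump r)
    = smult (psum (n + 1)) (monom 1 (n + r) * (monom 1 1 - 1))
      + (\<Sum>i=1..r. smult (psum i) (monom 1 i * jump (r - i)))"
proof -
  let ?f = "monom 1 (r - 1) * (monom 1 1 - 1) :: 'a poly"
  have "\<delta> ?f = 0"
    unfolding delta_step[OF assms(1)] using assms by (simp add: delta_monom_less)
  have 1: "\<delta> (monom 1 (n - i) * ?f) = (if i \<le> r then jump (r - i) else 0)" if "i \<le> n" for i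
  proof -
    have "monom 1 (n - i) * ?f = monom 1 (n - i + r - 1) * (monom 1 1 - 1)"
      unfolding mult.assoc[symmetric] mult_monom using assms by simp
    then have "\<delta> (monom 1 (n - i) * ?f) = \<delta> (monom 1 (n - i + r)) - \<delta> (monom 1 (n - i + r - 1))"
      using delta_step[of "n - i + r"] assms by (simp only: trans_le_add2)
    then show ?thesis using that assms
      by (auto simp: jump_def delta_monom_less)
  qed
  have "(\<Sum>i\<le>n. smult (psum i) (monom 1 i * \<delta> (monom 1 (n - i) * ?f)))
      = (\<Sum>i\<le>n. if i \<le> r then smult (psum i) (monom 1 i * jump (r - i)) else 0)"
  proof (intro sum.cong refl)
    fix i assume "i \<in> {..n}"
    then have i: "i \<le> n" by simp
    show "smult (psum i) (monom 1 i * \<delta> (monom 1 (n - i) * ?f))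
        = (if i \<le> r then smult (psum i) (monom 1 i * jump (r - i)) else 0)"
      unfolding 1[OF i] by simp
  qed
  also have "\<dots> = (\<Sum>i\<le>r. smult (psum i) (monom 1 i * jump (r - i)))"
    using assms by (intro sum.mono_neutral_cong_right) auto
  also have "\<dots> = smult (coeff u 0) (jump r) + (\<Sum>i=1..r. smult (psum i) (monom 1 i * jump (r - i)))"
    by (simp add: atMost_atLeast0 sum.atLeast_Suc_atMost psum_def monom_0 flip: one_pCons)
  finally have sum_zero: "smult (psum (n + 1)) (monom 1 (n + 1) * ?f) + (smult (coeff u 0) (jump r)
      + (\<Sum>i=1..r. smult (psum i) (monom 1 i * jump (r - i)))) = 0"
    using defect_identity[of ?f] \<open>\<delta> ?f = 0\<close> by simp
  have "monom 1 (n + 1) * ?f = monom 1 (n + r) * (monom 1 1 - 1)"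
    using assms by (simp add: mult_monom flip: mult.assoc)
  note sum_zero[unfolded this]
  moreover have "A + (B + S) = 0 \<Longrightarrow> - B = A + S" for A B S :: "'a poly"
    by (metis add.left_commute add_eq_0_iff)
  ultimately show ?thesis
    unfolding smult_minus_left by blast
qed

text \<open>Since \<open>u = \<delta> y\<^sup>n - \<delta> 1\<close>, this is the relation \<open>\<delta> (y\<^sup>s \<delta> f) = 0\<close> for \<open>f = y\<^sup>n\<close> and \<open>f = 1\<close>.\<close>
lemma vanishing_relation:
  assumes "s + 1 < n"
  shows "(\<Sum>j\<le>n + 1. smult (coeff u j) (\<delta> (monom 1 (j + s)))) = 0"
proof -
  have u: "u = \<delta> (monom 1 n) - \<delta> (monom 1 0)"
    using delta_monom_less[of 0] n_ge_2 by (simp add: delta_monom_n)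
  have "\<delta> (monom 1 s * u) = \<delta> (monom 1 s * \<delta> (monom 1 n)) - \<delta> (monom 1 s * \<delta> (monom 1 0))"
    by (subst u) (simp only: right_diff_distrib delta_diff)
  then have "\<delta> (monom 1 s * u) = 0"
    using assms by (simp add: delta_monom_delta)
  moreover have "monom 1 s * u = (\<Sum>j\<le>n + 1. smult (coeff u j) (monom 1 (j + s)))"
    by (subst u_expand) (simp add: sum_distrib_left distrib_left mult_monom add.commute)
  ultimately show ?thesis by (simp add: delta_sum delta_smult delta_add)
qed

section \<open>The coefficients of the deviation\<close>

text \<open>
  Let \<open>D\<close> be the degree of \<open>u\<close>, here at most \<open>n\<close>.  In the vanishing relation for \<open>s = n - D\<close> only the
  leading coefficient meets row \<open>n\<close>, so that \<open>u\<^sub>D u\<close> is a multiple of \<open>1 - y\<close>; hence \<open>D \<le> 1\<close>.  This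
  relation is available only if \<open>s \<le> n - 2\<close>; for \<open>D \<le> 1\<close> the one with \<open>s = 0\<close> shows that \<open>u\<close> has
  coefficient sum \<open>0\<close>.
\<close>
lemma last_coeff_zero_case:
  assumes "coeff u (n + 1) = 0"
  shows "(\<forall>j\<ge>2. coeff u j = 0) \<and> psum 1 = 0"
proof -
  let ?D = "degree u"
  have "?D \<le> n"
    using assms degree_u u_nonzero leading_coeff_0_iff[of u] by (metis add.commute le_SucE plus_1_eq_Suc)
  have "?D \<le> 1"
  proof (rule ccontr)
    assume "\<not> ?D \<le> 1"
    then have D: "2 \<le> ?D" by simp
    have "0 = (\<Sum>j\<le>n + 1. smult (coeff u j) (\<delta> (monom 1 (j + (n - ?D)))))"
      using vanishing_relation[of "n - ?D"] D \<open>?D \<le> n\<close> by simp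
    also have "\<dots> = (\<Sum>j\<le>?D. smult (coeff u j) (\<delta> (monom 1 (j + (n - ?D)))))"
      using \<open>?D \<le> n\<close> by (intro sum.mono_neutral_right) (auto simp: coeff_eq_0)
    also have "\<dots> = (\<Sum>j\<le>?D. smult (coeff u j) (1 - monom 1 1) + (if j = ?D then smult (coeff u ?D) u else 0))"
      using \<open>?D \<le> n\<close> by (intro sum.cong) (auto simp: delta_monom_less delta_monom_n smult_add_right)
    also have "\<dots> = smult (psum ?D) (1 - monom 1 1) + smult (coeff u ?D) u"
      by (simp add: sum.distrib psum_def smult_sum)
    finally have "coeff (smult (psum ?D) (1 - monom 1 1) + smult (coeff u ?D) u) ?D = 0"
      by simp
    then show False
      using D u_nonzero by (simp add: coeff_1)
  qed
  then have 1: "\<forall>j\<ge>2. coeff u j = 0"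
    by (auto intro: coeff_eq_0)
  have "0 = (\<Sum>j\<le>n + 1. smult (coeff u j) (\<delta> (monom 1 j)))"
    using vanishing_relation[of 0] n_ge_2 by simp
  also have "\<dots> = (\<Sum>j\<le>1. smult (coeff u j) (\<delta> (monom 1 j)))"
    using 1 by (intro sum.mono_neutral_right) auto
  also have "\<dots> = smult (psum 1) (1 - monom 1 1)"
    using n_ge_2 by (simp add: delta_monom_less psum_def smult_add_left)
  finally have "coeff (smult (psum 1) (1 - monom 1 1)) 0 = 0"
    by (metis coeff_0)
  with 1 show ?thesis by simp
qed

lemma first_recursion:
  "smult (- coeff u 0) (jump 1) = smult (psum (n + 1)) (monom 1 (n + 1) * (monom 1 1 - 1)) + smult (psum 1) (monom 1 1 * u)"
  using jump_recursion[of 1] n_ge_2 by (simp add: jump_0)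

text \<open>
  The vanishing relation for \<open>s = 0\<close> involves the rows up to \<open>n + 1\<close>, and row \<open>n + 1\<close> is \<open>1 - y + u\<close> plus
  the first jump.
\<close>
lemma jump_1_relation:
  "smult (psum (n + 1)) (1 - monom 1 1) + smult (coeff u n + coeff u (n + 1)) u
    + smult (coeff u (n + 1)) (jump 1) = 0"
proof -
  have "0 = (\<Sum>j\<le>n + 1. smult (coeff u j) (\<delta> (monom 1 j)))"
    using vanishing_relation[of 0] n_ge_2 by simp
  also have "\<dots> = (\<Sum>j\<le>n + 1. smult (coeff u j) (1 - monom 1 1)
      + (if j = n then smult (coeff u n) u else 0)
      + (if j = n + 1 then smult (coeff u (n + 1)) (u + jump 1) else 0))"
    by (intro sum.cong) (auto simp: delta_monom_less delta_monom_n smult_add_right jump_def smult_diff_right)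
  also have "\<dots> = smult (psum (n + 1)) (1 - monom 1 1) + smult (coeff u n) u + smult (coeff u (n + 1)) (u + jump 1)"
    unfolding sum.distrib by (simp add: psum_def smult_sum smult_add_left)
  finally show ?thesis
    by (simp add: smult_add_left smult_add_right algebra_simps)
qed

text \<open>
  The polynomial identity in \<open>u\<close> alone that remains after \<open>first_recursion\<close> has been substituted into
  \<open>jump_1_relation\<close>, multiplied by \<open>- u\<^sub>0\<close>.  For \<open>a \<noteq> 0\<close> its coefficients determine almost everything.
\<close>
lemma jump_1_elimination:
  "smult (- coeff u 0 * psum (n + 1)) (1 - monom 1 1)
    + smult (- coeff u 0 * (coeff u n + coeff u (n + 1))) u
    + smult (coeff u (n + 1) * psum (n + 1)) (monom 1 (n + 1) * (monom 1 1 - 1))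
    + smult (coeff u (n + 1) * psum 1) (monom 1 1 * u) = 0"
proof -
  have "0 = smult (- coeff u 0) (smult (psum (n + 1)) (1 - monom 1 1)
      + smult (coeff u n + coeff u (n + 1)) u + smult (coeff u (n + 1)) (jump 1))"
    using jump_1_relation by simp
  also have "\<dots> = smult (- coeff u 0 * psum (n + 1)) (1 - monom 1 1)
    + smult (- coeff u 0 * (coeff u n + coeff u (n + 1))) u
    + smult (coeff u (n + 1)) (smult (- coeff u 0) (jump 1))"
    unfolding smult_add_right smult_smult by (simp only: mult.commute)
  finally show ?thesis
    unfolding first_recursion smult_add_right smult_smult by (simp only: add.assoc)
qed

text \<open>The coefficient of \<open>y\<^bsup>n+2\<^esup>\<close> in \<open>jump_1_elimination\<close>.\<close>
lemma psum_total:
  assumes "coeff u (n + 1) \<noteq> 0"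
  shows "psum (n + 1) = - coeff u (n + 1) * psum 1"
proof -
  have "coeff u (n + 1) * (psum (n + 1) + coeff u (n + 1) * psum 1) = 0"
    using arg_cong[OF jump_1_elimination, of "\<lambda>p. coeff p (n + 2)"] n_ge_2
    by (simp add: coeff_monom_mult coeff_mult_monom_1 coeff_u_beyond coeff_1 algebra_simps)
  then show ?thesis
    using assms by (simp add: eq_neg_iff_add_eq_0)
qed

text \<open>
  If \<open>u\<^sub>0 = 0\<close>, the left side of \<open>first_recursion\<close> vanishes, and its coefficient of \<open>y\<^sup>2\<close> is
  \<open>(u\<^sub>0 + u\<^sub>1) u\<^sub>1 = (u\<^sub>0 + u\<^sub>1)\<^sup>2\<close>, as \<open>n + 1 > 2\<close>.
\<close>
lemma coeff_0_nonzero: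
  assumes "psum 1 \<noteq> 0"
  shows "coeff u 0 \<noteq> 0"
proof
  assume 0: "coeff u 0 = 0"
  have "psum 1 * coeff u 1 = 0"
    using arg_cong[OF first_recursion, of "\<lambda>p. coeff p 2"] n_ge_2 0
    by (auto simp: coeff_monom_mult)
  with 0 assms show False by (simp add: psum_def)
qed

text \<open>
  At the first \<open>r \<ge> 1\<close> with a nonzero partial sum, the recursion reads \<open>- u\<^sub>0\<close> times the \<open>r\<close>-th jump equals
  \<open>psum r\<close> times \<open>y\<^sup>r u\<close>.  This is absurd for \<open>u\<^sub>0 = 0\<close>.  Otherwise the jumps between \<open>1\<close> and \<open>r - 1\<close>
  vanish, so the rows \<open>n, \<dots>, n + r - 1\<close> coincide, and in the vanishing relation for \<open>s = r - 1\<close> the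
  \<open>r\<close>-th jump occurs only in row \<open>n + r\<close>, with coefficient \<open>a\<close>.  After division by \<open>u\<close> a constant plus
  a multiple of \<open>y\<^sup>r\<close> is zero, so that multiple is zero.
\<close>
lemma psum_eq_0:
  assumes "coeff u (n + 1) \<noteq> 0" "psum 1 = 0" "1 \<le> r" "r < n"
  shows "psum r = 0"
  using assms(3,4)
proof (induction r rule: less_induct)
  case (less r)
  let ?a = "coeff u (n + 1)"
  have total: "psum (n + 1) = 0"
    using psum_total assms by simp
  have rec: "smult (- coeff u 0) (jump i) = (if i = r then smult (psum r) (monom 1 r * u) else 0)"
    if "1 \<le> i" "i \<le> r" for i
  proof -
    have "smult (- coeff u 0) (jump i) = (\<Sum>j=1..i. smult (psum j) (monom 1 j * jump (i - j)))"
      using jump_recursion[of i] that less.prems total by simp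
    also have "\<dots> = (\<Sum>j=1..i. if j = r then smult (psum r) (monom 1 r * u) else 0)"
      using that less by (intro sum.cong) (auto simp: jump_0)
    finally show ?thesis using that by auto
  qed
  show ?case
  proof (cases "coeff u 0 = 0 \<or> r = 1")
    case True
    then show ?thesis
      using rec[of r] less.prems u_nonzero assms(2) by auto
  next
    case False
    then have r: "2 \<le> r" and u0: "coeff u 0 \<noteq> 0"
      using less.prems by auto
    have jump: "jump i = 0" if "1 \<le> i" "i < r" for i
      using rec[of i] that u0 by auto
    have d: "\<delta> (monom 1 (n + i)) = 1 - monom 1 1 + u" if "i < r" for i
      using that
    proof (induction i)
      case 0
      then show ?case by (simp add: delta_monom_n)
    next
      case (Suc i)
      then show ?case using jump[of "Suc i"] by (simp add: jump_def)
    qed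
    have dr: "\<delta> (monom 1 (n + r)) = 1 - monom 1 1 + u + jump r"
      using d[of "r - 1"] r by (simp add: jump_def)
    \<comment> \<open>\<open>q\<close> collects the coefficients that meet the rows from \<open>n\<close> on, where \<open>\<delta>\<close> contributes \<open>u\<close>.\<close>
    define q where "q = (\<Sum>j\<le>n + 1. if n \<le> j + (r - 1) then coeff u j else 0)"
    have "0 = (\<Sum>j\<le>n + 1. smult (coeff u j) (\<delta> (monom 1 (j + (r - 1)))))"
      using vanishing_relation[of "r - 1"] less.prems by simp
    also have "\<dots> = (\<Sum>j\<le>n + 1. smult (coeff u j) (1 - monom 1 1)
        + smult (if n \<le> j + (r - 1) then coeff u j else 0) u
        + (if j = n + 1 then smult ?a (jump r) else 0))"
    proof (intro sum.cong refl)
      fix j assume j: "j \<in> {..n + 1}"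
      consider "j + (r - 1) < n" | "n \<le> j + (r - 1)" "j < n + 1" | "j = n + 1"
        using j by force
      then show "smult (coeff u j) (\<delta> (monom 1 (j + (r - 1)))) = smult (coeff u j) (1 - monom 1 1)
        + smult (if n \<le> j + (r - 1) then coeff u j else 0) u
        + (if j = n + 1 then smult ?a (jump r) else 0)"
      proof cases
        case 1
        with r show ?thesis by (simp add: delta_monom_less)
      next
        case 2
        with r d[of "j + (r - 1) - n"] show ?thesis by (simp add: smult_add_right)
      next
        case 3
        with r dr show ?thesis by (simp add: smult_add_right)
      qed
    qed
    also have "\<dots> = smult (psum (n + 1)) (1 - monom 1 1) + smult q u + smult ?a (jump r)"
      unfolding sum.distrib by (simp add: psum_def smult_sum smult_add_left q_def)
    finally have "smult q u + smult ?a (jump r) = 0"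
      by (simp add: total[simplified])
    \<comment> \<open>Multiplication by \<open>- u\<^sub>0\<close> makes the jump explicit.\<close>
    then have "0 = smult (- coeff u 0) (smult q u + smult ?a (jump r))"
      by simp
    also have "\<dots> = smult (- coeff u 0 * q) u + smult ?a (smult (- coeff u 0) (jump r))"
      unfolding smult_add_right smult_smult by (simp only: mult.commute)
    also have "\<dots> = (smult (- coeff u 0 * q) 1 + smult (?a * psum r) (monom 1 r)) * u"
      using rec[of r] less.prems by (simp add: algebra_simps)
    finally have "(smult (- coeff u 0 * q) 1 + smult (?a * psum r) (monom 1 r)) * u = 0"
      by (rule sym)
    then have "smult (- coeff u 0 * q) 1 + smult (?a * psum r) (monom 1 r) = 0"
      using u_nonzero by (simp only: mult_eq_0_iff simp_thms)
    then have "coeff (smult (- coeff u 0 * q) 1 + smult (?a * psum r) (monom 1 r)) r = 0"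
      by (simp only: coeff_0)
    then show ?thesis
      using r assms(1) by (simp add: coeff_pCons split: nat.splits)
  qed
qed

lemma psum_1_zero_case:
  assumes "coeff u (n + 1) \<noteq> 0" "psum 1 = 0"
  shows "(\<forall>j. 2 \<le> j \<and> j < n \<longrightarrow> coeff u j = 0) \<and> coeff u n = - coeff u (n + 1)"
proof
  show "\<forall>j. 2 \<le> j \<and> j < n \<longrightarrow> coeff u j = 0"
  proof (intro allI impI)
    fix j assume j: "2 \<le> j \<and> j < n"
    then have "psum j = 0" "psum (j - 1) = 0"
      by (auto intro!: psum_eq_0[OF assms])
    with j show "coeff u j = 0"
      using psum_Suc[of "j - 1"] by simp
  qed
  have "psum (n + 1) = psum (n - 1) + coeff u n + coeff u (n + 1)"
    using psum_Suc[of n] psum_Suc[of "n - 1"] n_ge_2 by simp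
  moreover have "psum (n - 1) = 0"
    using psum_eq_0[OF assms, of "n - 1"] n_ge_2 by simp
  ultimately show "coeff u n = - coeff u (n + 1)"
    using psum_total[OF assms(1)] assms(2) by (simp add: eq_neg_iff_add_eq_0)
qed

text \<open>
  The coefficients of \<open>1\<close> and \<open>y\<close> in \<open>jump_1_elimination\<close>, combined with \<open>psum_total\<close>, give
  \<open>a + b \<noteq> 0\<close> and \<open>u\<^sub>1 = 0\<close>.  The coefficients of \<open>y\<^sup>j\<close> for \<open>2 \<le> j \<le> n\<close> are a two-term recursion that
  carries the zero on to \<open>u\<^sub>n\<close>.  Then the coefficient sum of \<open>u\<close> is \<open>u\<^sub>0 + a\<close> as well as \<open>- a u\<^sub>0\<close>.
\<close>
lemma psum_1_nonzero_case:
  assumes "coeff u (n + 1) \<noteq> 0" "psum 1 \<noteq> 0"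
  shows "(\<forall>j. 1 \<le> j \<and> j \<le> n \<longrightarrow> coeff u j = 0) \<and> (1 + coeff u 0) * (coeff u (n + 1) + 1) = 1"
proof -
  let ?a = "coeff u (n + 1)" and ?b = "coeff u n" and ?t = "- coeff u 0"
  have t: "?t \<noteq> 0"
    using coeff_0_nonzero[OF assms(2)] by simp
  have total: "psum (n + 1) = - ?a * psum 1"
    by (rule psum_total[OF assms(1)])
  have "?t * (psum (n + 1) - (?a + ?b) * ?t) = 0"
    using arg_cong[OF jump_1_elimination, of "\<lambda>p. coeff p 0"] n_ge_2
    by (simp add: coeff_monom_mult coeff_mult_monom_1 algebra_simps)
  then have p: "psum (n + 1) = (?a + ?b) * ?t"
    using t by (metis mult_eq_0_iff right_minus_eq)
  then have ab: "?a + ?b \<noteq> 0" using total assms by auto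
  have "?t * (- psum (n + 1) + (?a + ?b) * coeff u 1 - ?a * psum 1) = 0"
    using arg_cong[OF jump_1_elimination, of "\<lambda>p. coeff p 1"] n_ge_2
    by (simp add: coeff_monom_mult coeff_mult_monom_1 coeff_1 algebra_simps)
  then have u1: "coeff u 1 = 0" using t total ab by simp
  have zero: "coeff u j = 0" if "1 \<le> j" "j \<le> n" for j
    using that
  proof (induction j rule: nat_induct_at_least)
    case base
    show ?case by (fact u1)
  next
    case (Suc j)
    have "?t * (?a + ?b) * coeff u (Suc j) = 0"
      using arg_cong[OF jump_1_elimination, of "\<lambda>p. coeff p (Suc j)"] Suc
      by (simp add: coeff_monom_mult coeff_mult_monom_1 coeff_1 algebra_simps)
    then show ?case using t ab by simp
  qed
  have "psum (n + 1) = - ?t + ?a"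
  proof -
    have "psum (n + 1) = (\<Sum>j\<in>{0, n + 1}. coeff u j)"
      unfolding psum_def using zero by (intro sum.mono_neutral_right) (auto simp: not_less_eq_eq)
    then show ?thesis by simp
  qed
  with p zero[of n] n_ge_2 have "?a * ?t = ?a - ?t" by simp
  moreover have "(1 + coeff u 0) * (?a + 1) = 1 + (?a - ?t) - ?a * ?t"
    by (simp add: algebra_simps)
  ultimately show ?thesis using zero by simp
qed

lemma exceptional_row_shape:
  "\<forall>j. j \<notin> {0, 1, n, n + 1} \<longrightarrow> coeff u j = 0"
  "(coeff u 0 + coeff u 1 = 0 \<and> coeff u n = - coeff u (n + 1) \<and> (coeff u 0, coeff u (n + 1)) \<noteq> (0, 0)) \<or>
   (coeff u 1 = 0 \<and> coeff u n = 0 \<and> coeff u (n + 1) \<noteq> 0 \<and> (1 + coeff u 0) * (coeff u (n + 1) + 1) = 1)"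
proof -
  have psum_1: "psum 1 = coeff u 0 + coeff u 1"
    by (simp add: psum_def)
  consider "coeff u (n + 1) = 0" | "coeff u (n + 1) \<noteq> 0" "psum 1 = 0" | "coeff u (n + 1) \<noteq> 0" "psum 1 \<noteq> 0"
    by blast
  note cases = this
  show inner: "\<forall>j. j \<notin> {0, 1, n, n + 1} \<longrightarrow> coeff u j = 0"
  proof (intro allI impI)
    fix j assume "j \<notin> {0, 1, n, n + 1}"
    then consider "2 \<le> j" "j < n" | "j > n + 1" by force
    then show "coeff u j = 0"
    proof cases
      case 1
      then have "1 \<le> j" "j \<le> n" by simp_all
      from cases show ?thesis
      proof cases
        case 1
        with \<open>2 \<le> j\<close> show ?thesis using last_coeff_zero_case by blast
      next
        case 2
        with \<open>2 \<le> j\<close> \<open>j < n\<close> show ?thesis using psum_1_zero_case by blast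
      next
        case 3
        with \<open>1 \<le> j\<close> \<open>j \<le> n\<close> show ?thesis using psum_1_nonzero_case by blast
      qed
    next
      case 2
      then show ?thesis by (rule coeff_u_beyond)
    qed
  qed
  have nonzero: "(coeff u 0, coeff u (n + 1)) \<noteq> (0, 0)" if "psum 1 = 0" "coeff u n = - coeff u (n + 1)"
  proof
    assume "(coeff u 0, coeff u (n + 1)) = (0, 0)"
    then have "coeff u 0 = 0" "coeff u (n + 1) = 0"
      by simp_all
    moreover from this that have "coeff u 1 = 0" "coeff u n = 0"
      unfolding psum_1 by simp_all
    ultimately have "\<forall>j\<in>{0, 1, n, n + 1}. coeff u j = 0"
      by (simp only: ball_simps simp_thms)
    with inner have "coeff u j = 0" for j
      by metis
    then show False
      using u_nonzero by (simp add: poly_eq_iff)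
  qed
  from cases show "(coeff u 0 + coeff u 1 = 0 \<and> coeff u n = - coeff u (n + 1) \<and> (coeff u 0, coeff u (n + 1)) \<noteq> (0, 0)) \<or>
   (coeff u 1 = 0 \<and> coeff u n = 0 \<and> coeff u (n + 1) \<noteq> 0 \<and> (1 + coeff u 0) * (coeff u (n + 1) + 1) = 1)"
  proof cases
    case 1
    then have "psum 1 = 0" "coeff u n = - coeff u (n + 1)"
      using last_coeff_zero_case n_ge_2 by auto
    with nonzero psum_1 show ?thesis by simp
  next
    case 2
    then have "coeff u n = - coeff u (n + 1)"
      using psum_1_zero_case by blast
    with 2 nonzero psum_1 show ?thesis by simp
  next
    case 3
    then show ?thesis
      using psum_1_nonzero_case n_ge_2 by simp
  qed
qed

end

section \<open>The first exceptional row of a graded twisting map\<close>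

theorem proposition4p6:
  fixes \<tau> :: "'k::field twist"
    and M Mt :: "'k inf_matrix"
    and n :: nat
    and a b c d :: 'k
  assumes "graded_twisting_map \<tau>"
    and "is_matrix_of M \<tau>"
    and "M 1 = (\<lambda>j. if j = 0 then 1 else if j = 1 then -1 else if j = 2 then 1 else 0)"
    and "Mt = M - Y_matrix"
    and "n \<ge> 2"
    and "\<forall>k. 1 < k \<and> k < n \<longrightarrow> Mt k = Mt 0"
    and "Mt n \<noteq> Mt 0"
    and "a = Mt n (n + 1)"
    and "b = Mt n n"
    and "c = Mt n 1"
    and "d = Mt n 0"
  shows "(\<forall>j. j \<notin> {0, 1, n, n + 1} \<longrightarrow> Mt n j = 0) \<and>
    (((d, c, b, a) = (d, -d, -a, a) \<and> (d, a) \<noteq> (1, 0)) \<or>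
     ((d, c, b, a) = (d, -1, 0, a) \<and> a \<noteq> 0 \<and> d * (a + 1) = 1))"
proof -
  define \<mu> where "\<mu> = row_operator (\<lambda>k. x_to_one (\<tau> (basis (k, 1))))"
  have twisting: "twisting_map \<tau>"
    using assms(1) by (simp add: graded_twisting_map_def)
  have M: "is_matrix_of M \<tau>" by fact
  have cM: "coeff (\<mu> (monom 1 k)) j = M k j" for k j
    unfolding \<mu>_def by (rule coeff_mu_monom[OF twisting M])
  have above_superdiagonal: "M k j = 0" if "k + 1 < j" for k j
    using M that unfolding is_matrix_of_def by blast
  interpret op: commutation_operator \<mu>
  proof
    show "\<mu> (f + g) = \<mu> f + \<mu> g" for f g by (simp add: \<mu>_def row_operator_add)
    show "\<mu> (smult s f) = smult s (\<mu> f)" for s f by (simp add: \<mu>_def row_operator_smult)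
    show "degree (\<mu> (monom 1 k)) \<le> k + 1" for k
      by (intro degree_le allI impI) (simp only: cM above_superdiagonal)
    show "\<mu> (monom 1 k * f) = (\<Sum>j\<le>k + 1. smult (coeff (\<mu> (monom 1 k)) j)
        (monom 1 j * (\<mu> ^^ (k + 1 - j)) f))" for k f
      unfolding cM unfolding \<mu>_def by (rule twist_commutation[OF twisting M])
  qed
  have cMt: "coeff (op.\<delta> (monom 1 k)) j = Mt k j" for k j
    by (simp add: op.\<delta>_def cM mult_monom assms(4) Y_matrix_def)
  have "M 0 j = (if j = 0 then 1 else 0)" for j
  proof -
    have "\<tau> (1 \<otimes> basis 1) = basis 1 \<otimes> 1"
      using twisting unfolding twisting_map_def by blast
    then have "\<tau> (basis (0, 1)) = basis (1, 0)"
      by (simp flip: basis_0)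
    then have "\<mu> (monom 1 0) = monom 1 0"
      unfolding \<mu>_def row_operator_monom by simp
    then show ?thesis using cM[of 0 j] by (cases "j = 0") simp_all
  qed
  then have Mt0: "Mt 0 = (\<lambda>j. if j = 0 then 1 else if j = 1 then - 1 else 0)"
    by (auto simp: assms(4) Y_matrix_def)
  have Mt1: "Mt 1 = Mt 0"
    unfolding Mt0 unfolding assms(4) fun_diff_def assms(3)
    by (rule ext) (simp add: Y_matrix_def)
  have ordinary: "op.\<delta> (monom 1 k) = 1 - monom 1 1" if "Mt k = Mt 0" for k
    by (rule poly_eqI) (auto simp: cMt that Mt0 coeff_1)
  define u where "u = op.\<delta> (monom 1 n) - (1 - monom 1 1)"
  have cu: "coeff u j = Mt n j - Mt 0 j" for j
    by (auto simp: u_def cMt Mt0 coeff_1)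
  interpret row: first_exceptional_row \<mu> n u
  proof
    show "n \<ge> 2" by fact
    show "op.\<delta> (monom 1 k) = 1 - monom 1 1" if "k < n" for k
    proof (rule ordinary)
      consider "k = 0" | "k = 1" | "1 < k" by linarith
      then show "Mt k = Mt 0" using Mt1 assms(6) that by cases auto
    qed
    show "op.\<delta> (monom 1 n) = 1 - monom 1 1 + u" by (simp add: u_def)
    show "u \<noteq> 0"
    proof
      assume "u = 0"
      then have "Mt n j = Mt 0 j" for j using cu[of j] by simp
      with assms(7) show False by auto
    qed
  qed
  have entries: "coeff u 0 = d - 1" "coeff u 1 = c + 1" "coeff u n = b" "coeff u (n + 1) = a"
    using assms(5) by (simp_all add: cu Mt0 assms(8-11))
  have "Mt n j = 0" if "j \<notin> {0, 1, n, n + 1}" for j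
    using row.exceptional_row_shape(1) cu[of j] that by (auto simp: Mt0)
  moreover have "((d, c, b, a) = (d, -d, -a, a) \<and> (d, a) \<noteq> (1, 0)) \<or>
     ((d, c, b, a) = (d, -1, 0, a) \<and> a \<noteq> 0 \<and> d * (a + 1) = 1)"
    using row.exceptional_row_shape(2) unfolding entries
    by (auto simp: eq_neg_iff_add_eq_0 algebra_simps)
  ultimately show ?thesis by blast
qed

end
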